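(* Let $q\in\{0,2,4,6,\dots\}$ and let $a$ be a real number with $a>\frac{1}{A_q}$. Then for any $\theta\in[0,\pi]$ and any $E\in S_q$, there exist potentials $V:\mathbb{N}\to\mathbb{R}$ such that $\limsup_{n\to\infty}|nV(n)|=a$ and $E$ is an eigenvalue of the associated Schrödinger operator $H=H_0+V$ with boundary condition $\frac{u(1)}{u(0)}=\tan\theta$.
   Context: Here $\mathbb{N}=\{1,2,\dots\}$. The half-line discrete Schrödinger operator $H=H_0+V$ with boundary condition $\theta\in[0,\pi]$ is given by $(Hu)(n)=u(n+1)+u(n-1)+V(n)u(n)$ for $n\ge 1$, with $\frac{u(1)}{u(0)}=\tan\theta$ (i.e. $u(1)\cos\theta=u(0)\sin\theta$). A number $E$ is an eigenvalue if there is a nontrivial solution $u$ of $u(n+1)+u(n-1)+V(n)u(n)=Eu(n)$ ($n\ge1$) satisfying the boundary condition with $u\in\ell^2(\mathbb{N})$. For $E\in(-2,2)$, $k(E)\in(0,1)$ is defined by $E=2\cos\pi k(E)$. For an integer $q\ge2$, $S_q=\{E\in(-2,2): k(E)=p/q \text{ for some } p\in\{1,\dots,q-1\} \text{ with } \gcd(p,q)=1\}$, and $S_0=\{E\in(-2,2): k(E)\text{ is irrational}\}$. The constants are: $A_0=\frac{2}{\pi}$; for even $q\ge2$, $A_q=\frac{2}{q\sin(\pi/q)}$. *)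

theory Defs
  imports "HOL-Analysis.Analysis"
begin

text \<open>
  Sequences on \<open>\<nat> = {1, 2, \<dots>}\<close> are functions on \<^typ>\<open>nat\<close>. The value \<open>V 0\<close> of a potential is never
  used; the value \<open>u 0\<close> of a solution enters only through the boundary condition and the
  equation at \<open>n = 1\<close>.
\<close>

definition schroedinger :: "(nat \<Rightarrow> real) \<Rightarrow> (nat \<Rightarrow> complex) \<Rightarrow> nat \<Rightarrow> complex" where
  "schroedinger V u n = u (n + 1) + u (n - 1) + of_real (V n) * u n"

text \<open>
  The condition \<open>u 1 / u 0 = tan \<theta>\<close> is stated in the division-free form, which also covers
  \<open>\<theta> = \<pi> / 2\<close> (that is, \<open>u 0 = 0\<close>).
\<close>

definition boundary_condition :: "real \<Rightarrow> (nat \<Rightarrow> complex) \<Rightarrow> bool" where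
  "boundary_condition \<theta> u \<longleftrightarrow> u 1 * of_real (cos \<theta>) = u 0 * of_real (sin \<theta>)"

definition is_eigenvalue :: "(nat \<Rightarrow> real) \<Rightarrow> real \<Rightarrow> real \<Rightarrow> bool" where
  "is_eigenvalue V \<theta> E \<longleftrightarrow>
     (\<exists>u. (\<exists>n. u n \<noteq> 0) \<and>
          (\<forall>n\<ge>1. schroedinger V u n = of_real E * u n) \<and>
          boundary_condition \<theta> u \<and>
          (\<lambda>n. (cmod (u n))\<^sup>2) summable_on {1..})"

text \<open>Only meaningful for \<open>-2 < E < 2\<close>.\<close>

definition quasimomentum :: "real \<Rightarrow> real" where
  "quasimomentum E = (THE k. k \<in> {0<..<1} \<and> E = 2 * cos (pi * k))"

lemma quasimomentum_unique:
  assumes "E \<in> {-2<..<2}"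
  shows "\<exists>!k. k \<in> {0<..<1} \<and> E = 2 * cos (pi * k)"
proof (rule ex1I)
  have "0 < arccos (E / 2)" "arccos (E / 2) < pi"
    using arccos_lt_bounded[of "E / 2"] assms by auto
  then show "arccos (E / 2) / pi \<in> {0<..<1} \<and> E = 2 * cos (pi * (arccos (E / 2) / pi))"
    using assms by (auto simp: field_simps)
next
  fix k :: real
  assume k: "k \<in> {0<..<1} \<and> E = 2 * cos (pi * k)"
  then have "arccos (cos (pi * k)) = pi * k"
    by (intro arccos_cos) auto
  with k show "k = arccos (E / 2) / pi"
    by auto
qed

text \<open>The index \<open>q = 0\<close> stands for irrational quasimomentum.\<close>

definition S :: "nat \<Rightarrow> real set" where
  "S q = (if q = 0 then {E \<in> {-2<..<2}. quasimomentum E \<notin> \<rat>}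
          else {E \<in> {-2<..<2}. \<exists>p\<in>{1..q - 1}. gcd p q = 1 \<and> quasimomentum E = real p / real q})"

text \<open>Only meaningful for even \<open>q\<close>.\<close>

definition A :: "nat \<Rightarrow> real" where
  "A q = (if q = 0 then 2 / pi else 2 / (real q * sin (pi / real q)))"

end

theory Submission
  imports Defs "HOL-Analysis.Kronecker_Approximation_Theorem" "HOL-Real_Asymp.Real_Asymp"
begin

text \<open>
  The potential is built by feedback. Write \<open>E = 2 cos \<kappa>\<close> and encode a solution \<open>u\<close> by
  \<open>w n = e\<^sup>i\<^sup>\<kappa> u n - u (n - 1)\<close>, so that \<open>u n = Im (w n) / sin \<kappa>\<close> and the equation becomes
  \<open>w (n + 1) = e\<^sup>i\<^sup>\<kappa> (w n - v Im (w n))\<close> with \<open>v = V n / sin \<kappa>\<close>. If \<open>w n\<close> has argument \<open>\<phi>\<close>, then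
  \<open>\<bar>w (n + 1)\<bar>\<^sup>2 = \<bar>w n\<bar>\<^sup>2 (1 - v sin 2\<phi> + v\<^sup>2 sin\<^sup>2 \<phi>)\<close>. Taking \<open>V n = \<plusminus>a / n\<close> with the sign of
  \<open>sin 2\<phi>\<close> makes every step contract, to first order, as much as the bound \<open>a / n\<close> permits, and \<open>\<bar>n V n\<bar> = a\<close>
  for all \<open>n \<ge> 1\<close>. This feedback can be started from any nonzero initial vector, so \<open>\<theta>\<close> is arbitrary.

  Up to \<open>O(1/n)\<close> the angle \<open>2\<phi>\<close> moves by \<open>2\<kappa>\<close> per step. So if the averages of \<open>\<bar>sin (x + 2\<kappa>j)\<bar>\<close>
  over \<open>N\<close> consecutive \<open>j\<close> are at least \<open>\<delta>\<close> for every \<open>x\<close>, then \<open>\<bar>w\<bar>\<^sup>2\<close> decays roughly like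
  \<open>n\<close> to the power \<open>- a\<delta> / sin \<kappa>\<close>, which is summable once \<open>a\<delta> > sin \<kappa>\<close>
  (\<open>feedback_eigenvalue\<close>). It remains to find \<open>\<delta>\<close>.

  For irrational \<open>k\<close>, where \<open>\<kappa> = \<pi>k\<close>, any \<open>\<delta> < 2/\<pi>\<close> is possible
  (\<open>irrational_rotation_average_abs_sin\<close>), and \<open>sin \<kappa> \<le> 1\<close>.

  For \<open>k = p/q\<close> with \<open>q\<close> even the averages over \<open>q/2\<close> steps depend on \<open>x\<close>. Their maximum is \<open>A q\<close>,
  but their minimum is only \<open>\<delta> = A q cos (\<pi>/q)\<close>. When \<open>q \<ge> 4\<close> the loss is made up by \<open>sin \<kappa>\<close>:
  coprimality keeps \<open>p/q\<close> at distance at least \<open>1/q\<close> from \<open>1/2\<close>, so \<open>sin \<kappa> \<le> cos (\<pi>/q)\<close>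
  (\<open>sin_rational_le_cos\<close>) and even the worst phase decays fast enough.

  For \<open>q = 2\<close>, that is \<open>E = 0\<close>, the worst phase gives nothing. Here a solution that stays
  at the best phase is written down, with signs \<open>+ + - -\<close> and modulus \<open>n\<close> to the power \<open>- a/2\<close>, and
  the potential is read off from the equation (\<open>zero_energy_eigenvalue\<close>).
\<close>

section \<open>Averages of the absolute sine along a rotation\<close>

lemma abs_sin_add_int_pi: "\<bar>sin (x + pi * of_int m)\<bar> = \<bar>sin x\<bar>"
  by (simp add: sin_add sin_npi_int cos_npi_int abs_mult)

text \<open>An affine map with slope prime to \<open>Q\<close> permutes the residues modulo \<open>Q\<close>.\<close>

lemma sum_over_residues_affine:
  fixes h :: "int \<Rightarrow> real" and P s :: int
  assumes "coprime P (int Q)" and periodic: "\<And>i. h (i mod int Q) = h i"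
  shows "(\<Sum>j<Q. h (P * int j + s)) = (\<Sum>j<Q. h (int j))"
proof (cases "Q = 0")
  case False
  define \<rho> where "\<rho> j = nat ((P * int j + s) mod int Q)" for j
  have \<rho>_lt: "\<rho> j < Q" for j
    using False by (simp add: \<rho>_def nat_less_iff)
  have \<rho>_int: "int (\<rho> j) = (P * int j + s) mod int Q" for j
    using False by (simp add: \<rho>_def)
  have "inj_on \<rho> {..<Q}"
  proof (rule inj_onI)
    fix i j assume ij: "i \<in> {..<Q}" "j \<in> {..<Q}" "\<rho> i = \<rho> j"
    then have "(P * int i + s) mod int Q = (P * int j + s) mod int Q"
      by (metis \<rho>_int)
    then have "int Q dvd P * (int i - int j)"
      by (simp add: mod_eq_dvd_iff algebra_simps)
    then have "int Q dvd int i - int j"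
      using assms(1) by (meson coprime_commute coprime_dvd_mult_right_iff)
    then have "int i mod int Q = int j mod int Q"
      by (simp add: mod_eq_dvd_iff)
    then show "i = j" using ij by simp
  qed
  moreover have "\<rho> ` {..<Q} \<subseteq> {..<Q}"
    using \<rho>_lt by auto
  ultimately have "bij_betw \<rho> {..<Q} {..<Q}"
    by (simp add: bij_betw_def endo_inj_surj)
  then have "(\<Sum>j<Q. h (int (\<rho> j))) = (\<Sum>j<Q. h (int j))"
    by (rule sum.reindex_bij_betw)
  then show ?thesis
    by (simp add: \<rho>_int periodic)
qed simp

lemma sum_sin_telescope:
  "2 * sin (d / 2) * (\<Sum>j<m. sin (y + d * real j)) = cos (y - d / 2) - cos (y + d * real m - d / 2)"
proof (induction m)
  case (Suc m)
  have "2 * sin (d / 2) * sin (y + d * real m)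
      = cos (y + d * real m - d / 2) - cos (y + d * real (Suc m) - d / 2)"
  proof -
    have "y + d * real (Suc m) - d / 2 = (y + d * real m) + d / 2"
      by (simp add: algebra_simps)
    then show ?thesis
      by (simp only: cos_add cos_diff) simp
  qed
  with Suc show ?case by (simp add: algebra_simps)
qed simp

text \<open>
  The \<open>Q\<close> angles are equally spaced modulo \<open>\<pi>\<close>, so the sum depends only on \<open>x\<close> modulo \<open>\<pi>/Q\<close>.
  With \<open>y\<close> the representative in \<open>[0, \<pi>/Q]\<close> all the sines are nonnegative and the sum telescopes to
  \<open>cos (y - \<pi>/2Q) / sin (\<pi>/2Q)\<close>. The bound is its value at the worst phase \<open>y = 0\<close>.
\<close>

lemma sum_abs_sin_equidistant_ge:
  fixes P :: int
  assumes "Q > 0" "coprime P (int Q)"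
  shows "cot (pi / (2 * real Q)) \<le> (\<Sum>j<Q. \<bar>sin (x + pi * of_int P * real j / real Q)\<bar>)"
proof -
  define d where "d = pi / real Q"
  have d: "0 < d" "d \<le> pi" "d * real Q = pi"
    using assms(1) by (auto simp: d_def field_simps)
  \<comment> \<open>The shift from \<open>x\<close> to \<open>y\<close> becomes the offset \<open>s\<close> of an affine map on residues.\<close>
  define s where "s = \<lfloor>x / d\<rfloor>"
  define y where "y = x - d * of_int s"
  have s: "of_int s \<le> x / d" "x / d < of_int s + 1"
    unfolding s_def by linarith+
  have y: "0 \<le> y" "y \<le> d"
    using s d(1) by (auto simp: y_def field_simps)
  define h where "h i = \<bar>sin (y + d * of_int i)\<bar>" for i :: int
  have h_periodic: "h (i mod int Q) = h i" for i
  proof -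
    have "of_int i = real_of_int (i mod int Q) + real Q * of_int (i div int Q)"
      by (metis mod_mult_div_eq of_int_add of_int_mult of_int_of_nat_eq)
    then have "y + d * of_int i = (y + d * of_int (i mod int Q)) + pi * of_int (i div int Q)"
      by (simp add: algebra_simps flip: d(3))
    then show ?thesis
      unfolding h_def by (metis abs_sin_add_int_pi)
  qed
  have "(\<Sum>j<Q. \<bar>sin (x + pi * of_int P * real j / real Q)\<bar>) = (\<Sum>j<Q. h (P * int j + s))"
    by (simp add: h_def y_def d_def algebra_simps)
  also have "\<dots> = (\<Sum>j<Q. h (int j))"
    by (rule sum_over_residues_affine) (use assms h_periodic in auto)
  also have "\<dots> \<ge> (\<Sum>j<Q. sin (y + d * real j))"
    unfolding h_def by (intro sum_mono) simp
  finally have ge: "(\<Sum>j<Q. sin (y + d * real j)) \<le> (\<Sum>j<Q. \<bar>sin (x + pi * of_int P * real j / real Q)\<bar>)" .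
  have pos: "sin (d / 2) > 0"
    using d by (intro sin_gt_zero) auto
  have "cos (y + pi - d / 2) = - cos (y - d / 2)"
    using cos_periodic_pi[of "y - d / 2"] by (simp add: algebra_simps)
  then have "2 * sin (d / 2) * (\<Sum>j<Q. sin (y + d * real j)) = 2 * cos (y - d / 2)"
    using sum_sin_telescope[of d y Q] d(3) by simp
  moreover have "cos (d / 2) \<le> cos (y - d / 2)"
  proof -
    have "cos (d / 2) \<le> cos \<bar>y - d / 2\<bar>"
      using y d by (intro cos_monotone_0_pi_le) (auto simp: abs_if field_simps)
    then show ?thesis by (simp only: cos_abs_real)
  qed
  ultimately have "cot (d / 2) \<le> (\<Sum>j<Q. sin (y + d * real j))"
    using pos by (simp add: cot_def field_simps)
  also note ge
  finally show ?thesis by (simp add: d_def mult.commute)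
qed

text \<open>
  If \<open>\<bar>\<alpha> - P/N\<bar> < 1/N\<^sup>2\<close> with \<open>P\<close> and \<open>N\<close> coprime, then during \<open>N\<close> steps the
  rotation stays within \<open>\<pi>/N\<close> of the rational one. For the latter the average is at least
  \<open>cot (\<pi>/2N) / N\<close>, which tends to \<open>2/\<pi>\<close>. Irrationality of
  \<open>\<alpha>\<close> supplies such approximations with arbitrarily large \<open>N\<close>.
\<close>

lemma irrational_rotation_average_abs_sin:
  fixes \<alpha> c :: real
  assumes "\<alpha> \<notin> \<rat>" "c < 2 / pi"
  obtains N :: nat where "N > 0" "\<And>x. real N * c \<le> (\<Sum>j<N. \<bar>sin (x + pi * \<alpha> * real j)\<bar>)"
proof -
  have "((\<lambda>t. cot (pi / (2 * t)) / t - pi / t) \<longlongrightarrow> 2 / pi) at_top"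
    unfolding cot_def by real_asymp
  then have "eventually (\<lambda>t::real. cot (pi / (2 * t)) / t - pi / t > c) at_top"
    using assms(2) by (rule order_tendstoD)
  then obtain t0 where t0: "\<And>t. t \<ge> t0 \<Longrightarrow> cot (pi / (2 * t)) / t - pi / t > c"
    by (auto simp: eventually_at_top_linorder)
  have "infinite (approx_set \<alpha>)"
    using assms(1) rational_iff_finite_approx_set by blast
  then obtain P k where Pk: "(P, k) \<in> approx_set \<alpha>" "k > \<lceil>t0\<rceil>"
    using infinite_approx_set by blast
  define N where "N = nat k"
  have kN: "k = int N" and N: "N > 0" "real N \<ge> t0" and "coprime P (int N)"
    and approx: "\<bar>\<alpha> - of_int P / real N\<bar> < 1 / (real N)\<^sup>2"
    using Pk unfolding approx_set_def N_def by auto (linarith+)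
  have lip: "\<bar>sin s - sin t\<bar> \<le> \<bar>s - t\<bar>" for s t :: real
  proof -
    have "\<bar>sin s - sin t\<bar> = 2 * \<bar>sin ((s - t) / 2)\<bar> * \<bar>cos ((s + t) / 2)\<bar>"
      by (simp add: sin_diff_sin abs_mult)
    also have "\<dots> \<le> 2 * \<bar>(s - t) / 2\<bar> * 1"
      by (intro mult_mono mult_left_mono abs_sin_x_le_abs_x abs_cos_le_one) auto
    finally show ?thesis by simp
  qed
  show thesis
  proof (rule that[OF N(1)])
    fix x
    have "\<bar>sin (x + pi * of_int P * real j / real N)\<bar> - pi / real N \<le> \<bar>sin (x + pi * \<alpha> * real j)\<bar>"
      if "j < N" for j
    proof -
      have "\<bar>sin (x + pi * of_int P * real j / real N) - sin (x + pi * \<alpha> * real j)\<bar>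
          \<le> \<bar>pi * of_int P * real j / real N - pi * \<alpha> * real j\<bar>"
        using lip[of "x + pi * of_int P * real j / real N" "x + pi * \<alpha> * real j"] by simp
      also have "\<dots> = pi * real j * \<bar>\<alpha> - of_int P / real N\<bar>"
      proof -
        have "pi * of_int P * real j / real N - pi * \<alpha> * real j = - (pi * real j * (\<alpha> - of_int P / real N))"
          by (simp add: algebra_simps)
        then show ?thesis by (simp add: abs_mult)
      qed
      also have "\<dots> \<le> pi * real N * (1 / (real N)\<^sup>2)"
        using that approx by (intro mult_mono) auto
      also have "\<dots> = pi / real N"
        using N by (simp add: power2_eq_square)
      finally show ?thesis by linarith
    qed
    then have "(\<Sum>j<N. \<bar>sin (x + pi * of_int P * real j / real N)\<bar> - pi / real N)
        \<le> (\<Sum>j<N. \<bar>sin (x + pi * \<alpha> * real j)\<bar>)"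
      by (intro sum_mono) auto
    moreover have "(\<Sum>j<N. \<bar>sin (x + pi * of_int P * real j / real N)\<bar> - pi / real N)
        = (\<Sum>j<N. \<bar>sin (x + pi * of_int P * real j / real N)\<bar>) - pi"
      using N by (simp add: sum_subtractf)
    moreover have "cot (pi / (2 * real N)) \<le> (\<Sum>j<N. \<bar>sin (x + pi * of_int P * real j / real N)\<bar>)"
      using N \<open>coprime P (int N)\<close> by (intro sum_abs_sin_equidistant_ge)
    moreover have "real N * c \<le> cot (pi / (2 * real N)) - pi"
      using t0[OF N(2)] N(1) by (simp add: field_simps)
    ultimately show "real N * c \<le> (\<Sum>j<N. \<bar>sin (x + pi * \<alpha> * real j)\<bar>)"
      by linarith
  qed
qed

section \<open>Summability from decay along blocks\<close>

text \<open>
  A Raabe test with stride \<open>N\<close>. The sequence \<open>n G n\<close> loses at least \<open>(\<beta> - 1) N G n\<close> over \<open>N\<close> steps.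
  These losses telescope, hence have bounded partial sums.
\<close>

lemma summable_if_block_decay:
  fixes G :: "nat \<Rightarrow> real"
  assumes G: "\<And>n. G n \<ge> 0" and "N > 0" "\<beta> > 1"
    and decay: "eventually (\<lambda>n. G (n + N) \<le> G n * (1 - \<beta> * real N / real n)) sequentially"
  shows "summable G"
proof -
  obtain n0 where n0: "n0 \<ge> 1" "\<And>n. n \<ge> n0 \<Longrightarrow> G (n + N) \<le> G n * (1 - \<beta> * real N / real n)"
    using decay unfolding eventually_sequentially by (metis le_trans linorder_linear)
  define h where "h n = real (n + n0) * G (n + n0)" for n
  have h: "h n \<ge> 0" for n using G by (simp add: h_def)
  have drop: "(\<beta> - 1) * real N * G (n + n0) \<le> h n - h (n + N)" for n
  proof -
    let ?m = "n + n0"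
    have m: "real ?m > 0" using n0(1) by simp
    have "G (?m + N) \<le> G ?m * (1 - \<beta> * real N / real ?m)"
      using n0(2)[of ?m] by (simp del: of_nat_add)
    then have 1: "real ?m * G (?m + N) \<le> real ?m * G ?m - \<beta> * real N * G ?m"
      using m by (simp add: field_simps)
    have "\<beta> * real N * G ?m \<ge> 0" using G assms by simp
    with 1 have "real ?m * G (?m + N) \<le> real ?m * G ?m" by linarith
    then have "G (?m + N) \<le> G ?m" using m by simp
    then have "real N * G (?m + N) \<le> real N * G ?m" by (intro mult_left_mono) auto
    with 1 show ?thesis
      by (simp add: h_def algebra_simps)
  qed
  have "summable (\<lambda>n. G (n + n0))"
  proof (rule summableI_nonneg_bounded)
    fix m
    have "(\<beta> - 1) * real N * (\<Sum>n<m. G (n + n0)) \<le> (\<Sum>n<m. h n - h (n + N))"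
      unfolding sum_distrib_left by (intro sum_mono drop)
    also have "\<dots> = (\<Sum>n<m. h n) - (\<Sum>n<m. h (n + N))"
      by (simp add: sum_subtractf)
    also have "\<dots> \<le> (\<Sum>n<m + N. h n) - (\<Sum>n<m. h (n + N))"
      using h by (intro diff_right_mono sum_mono2) auto
    also have "(\<Sum>n<m + N. h n) = (\<Sum>n<N. h n) + (\<Sum>n<m. h (n + N))"
      by (induction m) simp_all
    finally have "(\<beta> - 1) * real N * (\<Sum>n<m. G (n + n0)) \<le> (\<Sum>n<N. h n)"
      by simp
    then show "(\<Sum>n<m. G (n + n0)) \<le> (\<Sum>n<N. h n) / ((\<beta> - 1) * real N)"
      using assms by (simp add: field_simps)
  qed (use G in auto)
  then show ?thesis by (simp add: summable_iff_shift)
qed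

section \<open>The feedback potential\<close>

text \<open>
  The sign of \<open>sin 2\<phi>\<close> for \<open>\<phi> = Arg z\<close>. It is \<open>1\<close> rather than \<open>0\<close> when \<open>sin 2\<phi> = 0\<close>, so that the
  potential has modulus exactly \<open>a / n\<close> everywhere.
\<close>

definition feedback_sign :: "complex \<Rightarrow> real" where
  "feedback_sign z = (if Re z * Im z \<ge> 0 then 1 else -1)"

lemma abs_feedback_sign [simp]: "\<bar>feedback_sign z\<bar> = 1"
  by (simp add: feedback_sign_def)

definition kick :: "real \<Rightarrow> complex \<Rightarrow> complex" where
  "kick v z = z - of_real (v * feedback_sign z * Im z)"

text \<open>
  At \<open>n = 0\<close> the strength \<open>b / 0\<close> is \<open>0\<close>, so the first step, from the initial vector to \<open>w 1\<close>, is a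
  free rotation.
\<close>

primrec orbit :: "real \<Rightarrow> real \<Rightarrow> complex \<Rightarrow> nat \<Rightarrow> complex" where
  "orbit \<kappa> b z 0 = z"
| "orbit \<kappa> b z (Suc n) = cis \<kappa> * kick (b / real n) (orbit \<kappa> b z n)"

lemma kick_nonzero: "z \<noteq> 0 \<Longrightarrow> kick v z \<noteq> 0"
  by (auto simp: kick_def complex_eq_iff)

lemma orbit_nonzero: "z \<noteq> 0 \<Longrightarrow> orbit \<kappa> b z n \<noteq> 0"
  by (induction n) (auto simp: kick_nonzero)

text \<open>
  The feedback sign turns the first-order term into \<open>- v \<bar>sin 2\<phi>\<bar>\<close>, where
  \<open>sin 2\<phi> = Im ((sgn z)\<^sup>2)\<close>. Squares of unit vectors stand in for double angles, so no branch of the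
  argument has to be chosen.
\<close>

lemma norm_kick_le:
  assumes "z \<noteq> 0"
  shows "(cmod (kick v z))\<^sup>2 \<le> (cmod z)\<^sup>2 * (1 - v * \<bar>Im ((sgn z)\<^sup>2)\<bar> + v\<^sup>2)"
proof -
  have "Im ((sgn z)\<^sup>2) = 2 * (Re z * Im z) / (cmod z)\<^sup>2"
    by (simp add: sgn_div_norm power2_eq_square scaleR_conv_of_real[symmetric] field_simps)
  then have *: "(cmod z)\<^sup>2 * \<bar>Im ((sgn z)\<^sup>2)\<bar> = 2 * \<bar>Re z * Im z\<bar>"
    using assms by (simp add: abs_mult)
  have "feedback_sign z * (Re z * Im z) = \<bar>Re z * Im z\<bar>"
    by (simp add: feedback_sign_def)
  moreover have "(feedback_sign z)\<^sup>2 = 1"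
    by (simp add: feedback_sign_def)
  moreover have "(cmod (kick v z))\<^sup>2
      = (cmod z)\<^sup>2 - 2 * v * (feedback_sign z * (Re z * Im z)) + v\<^sup>2 * (feedback_sign z)\<^sup>2 * (Im z)\<^sup>2"
    unfolding cmod_power2 kick_def by (simp add: power2_eq_square algebra_simps)
  ultimately have "(cmod (kick v z))\<^sup>2 = (cmod z)\<^sup>2 - v * (2 * \<bar>Re z * Im z\<bar>) + v\<^sup>2 * (Im z)\<^sup>2"
    by simp
  also have "\<dots> \<le> (cmod z)\<^sup>2 - v * (2 * \<bar>Re z * Im z\<bar>) + v\<^sup>2 * (cmod z)\<^sup>2"
    by (intro add_left_mono mult_left_mono) (auto simp: cmod_power2)
  also have "\<dots> = (cmod z)\<^sup>2 * (1 - v * \<bar>Im ((sgn z)\<^sup>2)\<bar> + v\<^sup>2)"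
    unfolding *[symmetric] by (simp add: algebra_simps)
  finally show ?thesis .
qed

lemma dist_sgn_le:
  fixes z z' :: complex
  assumes "z \<noteq> 0"
  shows "cmod (sgn z' - sgn z) \<le> 2 * cmod (z' - z) / cmod z"
proof -
  have "cmod (sgn z' - z' / cmod z) \<le> cmod (z' - z) / cmod z"
  proof (cases "z' = 0")
    case False
    have "sgn z' - z' / cmod z = sgn z' * of_real ((cmod z - cmod z') / cmod z)"
      using assms False by (simp add: sgn_eq field_simps)
    then have "cmod (sgn z' - z' / cmod z) = \<bar>cmod z - cmod z'\<bar> / cmod z"
      using False by (simp only: norm_mult norm_sgn norm_of_real) simp
    also have "\<dots> \<le> cmod (z' - z) / cmod z"
      using norm_triangle_ineq3[of z' z] by (intro divide_right_mono) (auto simp: abs_minus_commute)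
    finally show ?thesis .
  qed auto
  moreover have "cmod (z' / cmod z - sgn z) = cmod (z' - z) / cmod z"
    by (simp add: sgn_eq norm_divide flip: diff_divide_distrib)
  ultimately show ?thesis
    using norm_triangle_ineq[of "sgn z' - z' / cmod z" "z' / cmod z - sgn z"] by simp
qed

lemma dist_sgn_square_kick_le:
  assumes "z \<noteq> 0" "v \<ge> 0"
  shows "cmod ((sgn (kick v z))\<^sup>2 - (sgn z)\<^sup>2) \<le> 4 * v"
proof -
  have "cmod (kick v z - z) = v * \<bar>Im z\<bar>"
    using assms by (simp add: kick_def abs_mult flip: of_real_mult)
  also have "\<dots> \<le> v * cmod z"
    using assms abs_Im_le_cmod by (intro mult_left_mono)
  finally have "2 * cmod (kick v z - z) / cmod z \<le> 2 * v"
    using assms by (simp add: field_simps)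
  with dist_sgn_le[OF assms(1), of "kick v z"] have 1: "cmod (sgn (kick v z) - sgn z) \<le> 2 * v"
    by linarith
  have 2: "cmod (sgn (kick v z) + sgn z) \<le> 2"
    using norm_triangle_ineq[of "sgn (kick v z)" "sgn z"] assms by (simp add: norm_sgn split: if_splits)
  have "(sgn (kick v z))\<^sup>2 - (sgn z)\<^sup>2 = (sgn (kick v z) - sgn z) * (sgn (kick v z) + sgn z)"
    by (simp add: power2_eq_square algebra_simps)
  then have "cmod ((sgn (kick v z))\<^sup>2 - (sgn z)\<^sup>2) \<le> (2 * v) * 2"
    using mult_mono[OF 1 2] assms by (simp add: norm_mult)
  then show ?thesis by simp
qed

text \<open>
  Each kick perturbs the squared phase by at most \<open>4b/n\<close>, and rotations preserve the errors, which
  therefore only add up.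
\<close>

lemma orbit_phase_drift:
  assumes "z \<noteq> 0" "b \<ge> 0" "n \<ge> 1"
  shows "cmod ((sgn (orbit \<kappa> b z (n + j)))\<^sup>2 - cis (2 * \<kappa> * real j) * (sgn (orbit \<kappa> b z n))\<^sup>2)
         \<le> 4 * b * real j / real n"
proof (induction j)
  case (Suc j)
  let ?w = "orbit \<kappa> b z"
  let ?\<zeta> = "\<lambda>n. (sgn (?w n))\<^sup>2"
  let ?k = "kick (b / real (n + j)) (?w (n + j))"
  have "?\<zeta> (n + Suc j) - cis (2 * \<kappa> * real (Suc j)) * ?\<zeta> n
     = cis (2 * \<kappa>) * (((sgn ?k)\<^sup>2 - ?\<zeta> (n + j)) + (?\<zeta> (n + j) - cis (2 * \<kappa> * real j) * ?\<zeta> n))"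
  proof -
    have "sgn (cis \<kappa>) = cis \<kappa>" by (simp add: sgn_eq)
    then have "?\<zeta> (n + Suc j) = cis (2 * \<kappa>) * (sgn ?k)\<^sup>2"
      by (simp add: sgn_mult power_mult_distrib Complex.DeMoivre)
    moreover have "cis (2 * \<kappa> * real (Suc j)) = cis (2 * \<kappa>) * cis (2 * \<kappa> * real j)"
      by (simp add: cis_mult algebra_simps)
    ultimately show ?thesis by (simp add: algebra_simps)
  qed
  then have "cmod (?\<zeta> (n + Suc j) - cis (2 * \<kappa> * real (Suc j)) * ?\<zeta> n)
     \<le> cmod ((sgn ?k)\<^sup>2 - ?\<zeta> (n + j)) + cmod (?\<zeta> (n + j) - cis (2 * \<kappa> * real j) * ?\<zeta> n)"
    by (simp only: norm_mult norm_cis mult_1_left norm_triangle_ineq)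
  also have "\<dots> \<le> 4 * (b / real (n + j)) + 4 * b * real j / real n"
    using assms orbit_nonzero by (intro add_mono Suc dist_sgn_square_kick_le) auto
  also have "\<dots> \<le> 4 * (b / real n) + 4 * b * real j / real n"
    using assms by (intro add_right_mono mult_left_mono divide_left_mono) auto
  also have "\<dots> = 4 * b * real (Suc j) / real n"
    using assms by (simp add: field_simps)
  finally show ?case .
qed simp

lemma orbit_block_gain:
  assumes "z \<noteq> 0" "b \<ge> 0" "n \<ge> 1"
    and avg: "\<And>x. real N * \<delta> \<le> (\<Sum>j<N. \<bar>sin (x + 2 * \<kappa> * real j)\<bar>)"
  shows "real N * \<delta> - 4 * b * (real N)\<^sup>2 / real n \<le> (\<Sum>j<N. \<bar>Im ((sgn (orbit \<kappa> b z (n + j)))\<^sup>2)\<bar>)"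
proof -
  let ?\<zeta> = "\<lambda>n. (sgn (orbit \<kappa> b z n))\<^sup>2"
  obtain x where x: "?\<zeta> n = cis x"
  proof -
    have "cmod (?\<zeta> n) = 1"
      using orbit_nonzero[OF assms(1)] by (simp add: norm_power norm_sgn)
    then show ?thesis using that[of "Arg (?\<zeta> n)"]
      by (metis cis_Arg norm_zero sgn_div_norm zero_neq_one inverse_1 scaleR_one)
  qed
  have "\<bar>sin (x + 2 * \<kappa> * real j)\<bar> - 4 * b * real N / real n \<le> \<bar>Im (?\<zeta> (n + j))\<bar>" if "j < N" for j
  proof -
    have "cis (2 * \<kappa> * real j) * ?\<zeta> n = cis (x + 2 * \<kappa> * real j)"
      by (simp add: x cis_mult add.commute)
    then have "cmod (?\<zeta> (n + j) - cis (x + 2 * \<kappa> * real j)) \<le> 4 * b * real j / real n"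
      using orbit_phase_drift[OF assms(1-3), of \<kappa> j] by simp
    moreover have "\<dots> \<le> 4 * b * real N / real n"
      using assms that by (intro divide_right_mono mult_left_mono) auto
    moreover have "\<bar>Im (?\<zeta> (n + j)) - sin (x + 2 * \<kappa> * real j)\<bar> \<le> cmod (?\<zeta> (n + j) - cis (x + 2 * \<kappa> * real j))"
      using abs_Im_le_cmod[of "?\<zeta> (n + j) - cis (x + 2 * \<kappa> * real j)"] by simp
    ultimately show ?thesis by linarith
  qed
  then have "(\<Sum>j<N. \<bar>sin (x + 2 * \<kappa> * real j)\<bar> - 4 * b * real N / real n) \<le> (\<Sum>j<N. \<bar>Im (?\<zeta> (n + j))\<bar>)"
    by (intro sum_mono) auto
  moreover have "(\<Sum>j<N. \<bar>sin (x + 2 * \<kappa> * real j)\<bar> - 4 * b * real N / real n)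
      = (\<Sum>j<N. \<bar>sin (x + 2 * \<kappa> * real j)\<bar>) - 4 * b * (real N)\<^sup>2 / real n"
    by (simp add: sum_subtractf power2_eq_square)
  ultimately show ?thesis using avg[of x] by linarith
qed

lemma orbit_norm_le_exp:
  assumes "z \<noteq> 0" "b \<ge> 0" "n \<ge> 1"
  shows "(cmod (orbit \<kappa> b z (n + m)))\<^sup>2 \<le> (cmod (orbit \<kappa> b z n))\<^sup>2 *
     exp (\<Sum>j<m. (b / real (n + j))\<^sup>2 - b / real (n + j) * \<bar>Im ((sgn (orbit \<kappa> b z (n + j)))\<^sup>2)\<bar>)"
proof (induction m)
  case (Suc m)
  let ?w = "orbit \<kappa> b z"
  define t where "t j = (b / real (n + j))\<^sup>2 - b / real (n + j) * \<bar>Im ((sgn (?w (n + j)))\<^sup>2)\<bar>" for j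
  have "(cmod (?w (n + Suc m)))\<^sup>2 = (cmod (kick (b / real (n + m)) (?w (n + m))))\<^sup>2"
    by (simp add: norm_mult)
  also have "\<dots> \<le> (cmod (?w (n + m)))\<^sup>2 * (1 + t m)"
    using norm_kick_le[OF orbit_nonzero[OF assms(1)], of "b / real (n + m)" \<kappa> b "n + m"]
    by (simp add: t_def algebra_simps)
  also have "\<dots> \<le> (cmod (?w (n + m)))\<^sup>2 * exp (t m)"
    by (intro mult_left_mono exp_ge_add_one_self) auto
  also have "\<dots> \<le> ((cmod (?w n))\<^sup>2 * exp (\<Sum>j<m. t j)) * exp (t m)"
    using Suc by (intro mult_right_mono) (auto simp: t_def)
  finally show ?case by (simp add: t_def exp_add mult_ac)
qed simp

text \<open>
  Over a block of length \<open>N\<close> the squared modulus is multiplied by at most \<open>exp (X n)\<close>, where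
  \<open>X n = - b \<delta> N / n + O(1/n\<^sup>2)\<close>. Since \<open>b \<delta> > 1\<close>, any \<open>\<beta>\<close> strictly between \<open>1\<close> and \<open>b \<delta>\<close>
  absorbs the error term.
\<close>

lemma orbit_square_summable:
  assumes "z \<noteq> 0" "b > 0" "N > 0" "b * \<delta> > 1"
    and avg: "\<And>x. real N * \<delta> \<le> (\<Sum>j<N. \<bar>sin (x + 2 * \<kappa> * real j)\<bar>)"
  shows "summable (\<lambda>n. (cmod (orbit \<kappa> b z n))\<^sup>2)"
proof (rule summable_if_block_decay)
  let ?w = "orbit \<kappa> b z"
  define g where "g n = \<bar>Im ((sgn (?w n))\<^sup>2)\<bar>" for n
  define \<beta> where "\<beta> = (1 + b * \<delta>) / 2"
  show "\<beta> > 1" using assms by (simp add: \<beta>_def)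
  define M where "M = real N"
  define X where "X x = M * (b / x)\<^sup>2 - b / (x + M) * (M * \<delta> - 4 * b * M\<^sup>2 / x)" for x :: real
  have M: "M > 0" using assms by (simp add: M_def)
  have \<delta>: "\<delta> > 0" using assms(2,4) by (metis less_trans zero_less_mult_pos zero_less_one)
  have "((\<lambda>x. x * (1 - exp (X x))) \<longlongrightarrow> M * b * \<delta>) at_top"
    unfolding X_def using M \<open>b > 0\<close> \<delta> by real_asymp
  moreover have "\<beta> * M < M * b * \<delta>"
    using M assms by (simp add: \<beta>_def field_simps)
  ultimately have "eventually (\<lambda>x. x * (1 - exp (X x)) > \<beta> * M) at_top"
    by (rule order_tendstoD)
  then have "eventually (\<lambda>n. real n * (1 - exp (X (real n))) > \<beta> * M) sequentially"
    using filterlim_real_sequentially by (rule eventually_compose_filterlim)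
  then show "eventually (\<lambda>n. (cmod (?w (n + N)))\<^sup>2 \<le> (cmod (?w n))\<^sup>2 * (1 - \<beta> * real N / real n)) sequentially"
    using eventually_ge_at_top[of 1]
  proof eventually_elim
    case (elim n)
    have n: "real n > 0" using elim by simp
    have "(\<Sum>j<N. (b / real (n + j))\<^sup>2 - b / real (n + j) * g (n + j))
       \<le> (\<Sum>j<N. (b / real n)\<^sup>2 - b / (real n + M) * g (n + j))"
    proof (intro sum_mono diff_mono mult_right_mono power_mono divide_left_mono)
    qed (use n M assms in \<open>auto simp: M_def g_def\<close>)
    also have "\<dots> = M * (b / real n)\<^sup>2 - b / (real n + M) * (\<Sum>j<N. g (n + j))"
      by (simp add: sum_subtractf sum_distrib_left M_def)
    also have "\<dots> \<le> X (real n)"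
      unfolding X_def
      using orbit_block_gain[OF assms(1) _ elim(2) avg, of b] n M assms(2)
      by (intro diff_left_mono mult_left_mono) (auto simp: M_def g_def)
    finally have "exp (\<Sum>j<N. (b / real (n + j))\<^sup>2 - b / real (n + j) * g (n + j)) \<le> exp (X (real n))"
      by simp
    moreover have "exp (X (real n)) \<le> 1 - \<beta> * real N / real n"
      using elim n by (simp add: M_def field_simps)
    ultimately have "exp (\<Sum>j<N. (b / real (n + j))\<^sup>2 - b / real (n + j) * g (n + j)) \<le> 1 - \<beta> * real N / real n"
      by linarith
    then have "(cmod (?w n))\<^sup>2 * exp (\<Sum>j<N. (b / real (n + j))\<^sup>2 - b / real (n + j) * g (n + j))
        \<le> (cmod (?w n))\<^sup>2 * (1 - \<beta> * real N / real n)"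
      by (intro mult_left_mono) auto
    with orbit_norm_le_exp[OF assms(1) _ elim(2), of b \<kappa> N] \<open>b > 0\<close> show ?case
      unfolding g_def by linarith
  qed
qed (use assms in auto)

lemma limsup_eventually_const:
  assumes "\<And>n. n \<ge> 1 \<Longrightarrow> f n = (c::ereal)"
  shows "limsup f = c"
proof -
  have "eventually (\<lambda>n. f n = c) sequentially"
    using assms by (auto simp: eventually_sequentially)
  then have "limsup f = limsup (\<lambda>_::nat. c)" by (rule Limsup_eq)
  then show ?thesis by (simp add: Limsup_const)
qed

lemma is_eigenvalueI:
  fixes u :: "nat \<Rightarrow> real"
  assumes "u 0 = cos \<theta>" "u 1 = sin \<theta>"
    and rec: "\<And>n. n \<ge> 1 \<Longrightarrow> u (n + 1) + u (n - 1) + V n * u n = E * u n"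
    and "summable (\<lambda>n. (u n)\<^sup>2)"
  shows "is_eigenvalue V \<theta> E"
  unfolding is_eigenvalue_def
proof (intro exI[of _ "\<lambda>n. complex_of_real (u n)"] conjI)
  show "\<exists>n. complex_of_real (u n) \<noteq> 0"
  proof (rule ccontr)
    assume "\<nexists>n. complex_of_real (u n) \<noteq> 0"
    then have "u 0 = 0" "u 1 = 0" by auto
    then show False using assms(1,2) sin_cos_squared_add[of \<theta>] by simp
  qed
  show "\<forall>n\<ge>1. schroedinger V (\<lambda>n. complex_of_real (u n)) n = of_real E * of_real (u n)"
    unfolding schroedinger_def using rec by (simp flip: of_real_add of_real_mult)
  show "boundary_condition \<theta> (\<lambda>n. complex_of_real (u n))"
    unfolding boundary_condition_def using assms(1,2) by simp
  have "(\<lambda>n. (u n)\<^sup>2) summable_on UNIV"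
    using assms(4) by (subst summable_on_UNIV_nonneg_real_iff) auto
  then have "(\<lambda>n. (u n)\<^sup>2) summable_on {1..}"
    by (rule summable_on_subset) auto
  then show "(\<lambda>n. (cmod (complex_of_real (u n)))\<^sup>2) summable_on {1..}"
    by simp
qed

text \<open>
  The second-order equation for \<open>u\<close> is equivalent to the first-order recursion for \<open>w\<close> together with
  \<open>Re (w n) = cos \<kappa> u n - u (n - 1)\<close>. This identity holds from \<open>n = 1\<close> on whatever \<open>w 0\<close> is, because it
  expresses \<open>sin\<^sup>2 \<kappa> + cos\<^sup>2 \<kappa> = 1\<close>.
\<close>

theorem feedback_eigenvalue:
  fixes a \<theta> \<kappa> \<delta> :: real
  assumes "0 < \<kappa>" "\<kappa> < pi" "a > 0" "N > 0" "a * \<delta> > sin \<kappa>"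
    and avg: "\<And>x. real N * \<delta> \<le> (\<Sum>j<N. \<bar>sin (x + 2 * \<kappa> * real j)\<bar>)"
  shows "\<exists>V :: nat \<Rightarrow> real. limsup (\<lambda>n. ereal \<bar>real n * V n\<bar>) = ereal a \<and> is_eigenvalue V \<theta> (2 * cos \<kappa>)"
proof -
  define b where "b = a / sin \<kappa>"
  have s: "sin \<kappa> > 0" using assms by (intro sin_gt_zero) auto
  have b: "b > 0" "b * \<delta> > 1" using s assms by (auto simp: b_def field_simps)
  \<comment> \<open>\<open>z = e\<^sup>i\<^sup>\<kappa> u 0 - u (- 1)\<close>, where \<open>u (- 1)\<close> continues the free equation backwards from
    \<open>u 0 = cos \<theta>\<close> and \<open>u 1 = sin \<theta>\<close>.\<close>
  define z where "z = Complex (sin \<theta> - cos \<kappa> * cos \<theta>) (sin \<kappa> * cos \<theta>)"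
  have "z \<noteq> 0"
  proof
    assume "z = 0"
    then have "cos \<theta> = 0" "sin \<theta> = 0" using s by (auto simp: z_def complex_eq_iff)
    then show False using sin_cos_squared_add[of \<theta>] by simp
  qed
  define w where "w = orbit \<kappa> b z"
  define V where "V n = a / real n * feedback_sign (w n)" for n
  define u where "u n = Im (w n) / sin \<kappa>" for n
  have w_Suc: "w (Suc n) = cis \<kappa> * (w n - of_real (V n * u n))" for n
    using s by (simp add: w_def V_def u_def kick_def b_def)
  have u_Suc: "u (Suc n) = Re (w n) - V n * u n + cos \<kappa> * u n" for n
    using s unfolding u_def w_Suc by (simp add: u_def field_simps)
  have "u 0 = cos \<theta>" using s by (simp add: u_def w_def z_def)
  moreover have "u 1 = sin \<theta>"
    using u_Suc[of 0] \<open>u 0 = cos \<theta>\<close> by (simp add: V_def) (simp add: w_def z_def)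
  moreover have "u (n + 1) + u (n - 1) + V n * u n = 2 * cos \<kappa> * u n" if "n \<ge> 1" for n
  proof -
    from that obtain m where n: "n = Suc m" by (cases n) auto
    have "sin \<kappa> * u m = Im (w m)" using s by (simp add: u_def)
    then have "Re (w n) = cos \<kappa> * (Re (w m) - V m * u m) - sin \<kappa> * (sin \<kappa> * u m)"
      unfolding n w_Suc by simp
    moreover have "sin \<kappa> * sin \<kappa> * u m + cos \<kappa> * cos \<kappa> * u m = u m"
      using sin_cos_squared_add3[of \<kappa>] by (simp flip: distrib_right add: add.commute)
    ultimately have "Re (w n) - cos \<kappa> * u n = - u m"
      unfolding n u_Suc by (simp add: algebra_simps)
    then show ?thesis
      using u_Suc[of n] by (simp add: n)
  qed
  moreover have "summable (\<lambda>n. (u n)\<^sup>2)"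
  proof (rule summable_comparison_test')
    show "summable (\<lambda>n. (cmod (w n))\<^sup>2 / (sin \<kappa>)\<^sup>2)"
      unfolding w_def using assms b \<open>z \<noteq> 0\<close> by (intro summable_divide orbit_square_summable)
    show "norm ((u n)\<^sup>2) \<le> (cmod (w n))\<^sup>2 / (sin \<kappa>)\<^sup>2" for n
      by (simp add: u_def power_divide cmod_power2 divide_right_mono)
  qed
  ultimately have "is_eigenvalue V \<theta> (2 * cos \<kappa>)"
    by (rule is_eigenvalueI)
  moreover have "limsup (\<lambda>n. ereal \<bar>real n * V n\<bar>) = ereal a"
    using assms by (intro limsup_eventually_const) (simp add: V_def abs_mult)
  ultimately show ?thesis by blast
qed


section \<open>Energy zero\<close>

text \<open>
  For \<open>u n = \<sigma> n * r n\<close> with \<open>\<sigma> n = (-1) ^ (n div 2)\<close> we have \<open>\<sigma> (n + 2) = - \<sigma> n\<close>, hence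
  \<open>\<bar>V n\<bar> = \<bar>r (n + 1) - r (n - 1)\<bar> / r n\<close>, which is asymptotic to \<open>a / n\<close> for \<open>r n = n powr (- a / 2)\<close>.
  The limit superior depends only on large \<open>n\<close>, so the boundary values can be joined to this tail:
  as long as \<open>u n \<noteq> 0\<close>, a choice of \<open>V n\<close> makes \<open>u (n + 1)\<close> arbitrary. If \<open>u 1 = 0\<close>, the equation at
  \<open>1\<close> forces \<open>u 2 = - u 0\<close>, which is nonzero, and the freedom starts one step later.
\<close>

theorem zero_energy_eigenvalue:
  fixes a \<theta> :: real
  assumes "a > 1"
  shows "\<exists>V :: nat \<Rightarrow> real. limsup (\<lambda>n. ereal \<bar>real n * V n\<bar>) = ereal a \<and> is_eigenvalue V \<theta> 0"
proof -
  define c where "c = a / 2"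
  define r where "r n = real n powr (- c)" for n
  define u where "u n = (if n = 0 then cos \<theta> else if n = 1 then sin \<theta>
      else if n = 2 then (if sin \<theta> = 0 then - cos \<theta> else 1) else (-1) ^ (n div 2) * r n)" for n
  define V where "V n = (if u n = 0 then 0 else - (u (n + 1) + u (n - 1)) / u n)" for n
  have u_ge3: "u n = (-1) ^ (n div 2) * r n" if "n \<ge> 3" for n
    using that by (simp add: u_def)
  have u_nonzero: "u n \<noteq> 0" if "n \<ge> 2" for n
  proof (cases "n = 2")
    case True
    then show ?thesis using sin_zero_abs_cos_one[of \<theta>] by (auto simp: u_def)
  qed (use that in \<open>auto simp: u_ge3 r_def\<close>)
  have "is_eigenvalue V \<theta> 0"
  proof (rule is_eigenvalueI[where u = u])
    show "u (n + 1) + u (n - 1) + V n * u n = 0 * u n" if "n \<ge> 1" for n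
    proof (cases "u n = 0")
      case True
      then have "n = 1" using u_nonzero[of n] that by force
      then show ?thesis using True by (simp add: u_def V_def)
    qed (simp add: V_def)
    have "eventually (\<lambda>n. (u n)\<^sup>2 = real n powr (- a)) sequentially"
      using eventually_ge_at_top[of 3]
    proof eventually_elim
      case (elim n)
      then show ?case
        by (simp add: u_ge3 r_def c_def power_mult_distrib powr_power flip: power_mult)
    qed
    moreover have "summable (\<lambda>n. real n powr (- a))"
      using assms by (simp add: summable_real_powr_iff)
    ultimately show "summable (\<lambda>n. (u n)\<^sup>2)"
      by (simp add: summable_cong)
  qed (simp_all add: u_def)
  moreover have "limsup (\<lambda>n. ereal \<bar>real n * V n\<bar>) = ereal a"
  proof (rule lim_imp_Limsup)
    have c: "c > 0" using assms by (simp add: c_def)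
    have "((\<lambda>x. \<bar>x * ((x + 1) powr (- c) - (x - 1) powr (- c)) / x powr (- c)\<bar>) \<longlongrightarrow> 2 * c) at_top"
      using c by real_asymp
    then have "(\<lambda>n. \<bar>real n * ((real n + 1) powr (- c) - (real n - 1) powr (- c)) / real n powr (- c)\<bar>)
        \<longlonglongrightarrow> 2 * c"
      using filterlim_real_sequentially by (rule filterlim_compose)
    moreover have "eventually (\<lambda>n. \<bar>real n * ((real n + 1) powr (- c) - (real n - 1) powr (- c)) / real n powr (- c)\<bar>
        = \<bar>real n * V n\<bar>) sequentially"
      using eventually_ge_at_top[of 4]
    proof eventually_elim
      case (elim n)
      then obtain m where n: "n = Suc m" "m \<ge> 3" by (cases n) auto
      have "u (n + 1) + u (n - 1) = - ((-1) ^ (m div 2)) * (r (n + 1) - r m)"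
        using n by (simp add: u_ge3 algebra_simps)
      then have "\<bar>V n\<bar> = \<bar>r (n + 1) - r m\<bar> / r n"
        using n u_nonzero[of n] by (simp add: V_def u_ge3 abs_mult power_abs r_def)
      then show ?case
        using n by (simp add: r_def abs_mult add.commute)
    qed
    ultimately have "(\<lambda>n. \<bar>real n * V n\<bar>) \<longlonglongrightarrow> 2 * c"
      by (simp add: Lim_transform_eventually)
    then show "(\<lambda>n. ereal \<bar>real n * V n\<bar>) \<longlonglongrightarrow> ereal a"
      by (simp add: c_def)
  qed simp
  ultimately show ?thesis by blast
qed

section \<open>The threshold\<close>

text \<open>
  If \<open>2 p = q\<close> then \<open>p\<close> divides \<open>q\<close>, so \<open>p = 1\<close> and \<open>q = 2\<close>. Otherwise \<open>q - 2 p\<close> is a nonzero even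
  number, hence \<open>p/q\<close> is at distance at least \<open>1/q\<close> from the maximum of the sine at \<open>1/2\<close>.
\<close>

lemma sin_rational_le_cos:
  assumes "even q" "q \<ge> 4" "p \<ge> 1" "p < q" "coprime p q"
  shows "sin (pi * (real p / real q)) \<le> cos (pi / real q)"
proof -
  have "2 * p \<noteq> q"
  proof
    assume "2 * p = q"
    then have "p dvd q" by auto
    then have "p = 1" using assms(5) by (metis coprime_absorb_left nat_dvd_1_iff_1)
    then show False using \<open>2 * p = q\<close> assms(2) by simp
  qed
  then have "\<bar>int q - 2 * int p\<bar> \<ge> 2"
    using assms(1) by presburger
  then have "2 \<le> \<bar>real q - 2 * real p\<bar>"
    by linarith
  then have "pi / real q \<le> \<bar>pi / 2 - pi * (real p / real q)\<bar>"
  proof -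
    have "pi / 2 - pi * (real p / real q) = pi / (2 * real q) * (real q - 2 * real p)"
      using assms by (simp add: field_simps)
    then have "\<bar>pi / 2 - pi * (real p / real q)\<bar> = pi / (2 * real q) * \<bar>real q - 2 * real p\<bar>"
      by (simp add: abs_mult)
    also have "\<dots> \<ge> pi / (2 * real q) * 2"
      using \<open>2 \<le> \<bar>real q - 2 * real p\<bar>\<close> by (intro mult_left_mono) auto
    finally show ?thesis by simp
  qed
  moreover have "\<bar>pi / 2 - pi * (real p / real q)\<bar> \<le> pi"
  proof -
    have "real p / real q \<le> 1" using assms by simp
    then have "pi * (real p / real q) \<le> pi * 1" by (intro mult_left_mono) auto
    moreover have "pi * (real p / real q) \<ge> 0" by simp
    ultimately show ?thesis using pi_gt_zero by (simp only: abs_le_iff) linarith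
  qed
  ultimately have "cos \<bar>pi / 2 - pi * (real p / real q)\<bar> \<le> cos (pi / real q)"
    by (intro cos_monotone_0_pi_le) auto
  then show ?thesis by (simp add: sin_cos_eq)
qed

theorem theorem2p3:
  fixes q :: nat and a \<theta> E :: real
  assumes "even q"
    and "a > 1 / A q"
    and "\<theta> \<in> {0..pi}"
    and "E \<in> S q"
  shows "\<exists>V :: nat \<Rightarrow> real.
           limsup (\<lambda>n. ereal \<bar>real n * V n\<bar>) = ereal a \<and> is_eigenvalue V \<theta> E"
proof -
  define k where "k = quasimomentum E"
  have "E \<in> {-2<..<2}" using assms(4) by (auto simp: S_def split: if_splits)
  then have k: "0 < k" "k < 1" "E = 2 * cos (pi * k)"
    using theI'[OF quasimomentum_unique] unfolding k_def quasimomentum_def by auto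
  have \<kappa>: "0 < pi * k" "pi * k < pi"
    using k by auto
  consider "q = 0" | "q = 2" | "q \<ge> 4"
    using assms(1) by (elim evenE) force
  then show ?thesis
  proof cases
    case 1
    then have "k \<notin> \<rat>" using assms(4) by (simp add: S_def k_def)
    have "2 * k \<notin> \<rat>"
    proof
      assume "2 * k \<in> \<rat>"
      then have "2 * k / 2 \<in> \<rat>" by (rule Rats_divide) simp
      with \<open>k \<notin> \<rat>\<close> show False by simp
    qed
    have a: "a > pi / 2" using assms(2) 1 by (simp add: A_def)
    then have "a > 0" using pi_gt_zero by linarith
    have "1 / a < 2 / pi"
      using a \<open>a > 0\<close> by (simp add: field_simps)
    then obtain c where c: "1 / a < c" "c < 2 / pi" using dense by blast
    obtain N where N: "N > 0" "\<And>x. real N * c \<le> (\<Sum>j<N. \<bar>sin (x + pi * (2 * k) * real j)\<bar>)"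
      using irrational_rotation_average_abs_sin[OF \<open>2 * k \<notin> \<rat>\<close> c(2)] by blast
    have "1 < a * c" using c(1) \<open>a > 0\<close> by (simp add: field_simps)
    then have "sin (pi * k) < a * c" using sin_le_one[of "pi * k"] by linarith
    then show ?thesis
      unfolding k(3) using \<kappa> \<open>a > 0\<close> N by (intro feedback_eigenvalue) (auto simp: mult_ac)
  next
    case 2
    then have "k = 1 / 2" using assms(4) by (auto simp: S_def k_def)
    then have "E = 2 * cos (pi * (1 / 2))" using k(3) by (simp only:)
    then have "E = 0" by simp
    moreover have "a > 1" using assms(2) 2 by (simp add: A_def)
    ultimately show ?thesis using zero_energy_eigenvalue by simp
  next
    case 3
    then obtain p where p': "p \<in> {1..q - 1}" "gcd p q = 1" "k = real p / real q"
      using assms(4) unfolding S_def k_def by auto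
    then have p: "p \<ge> 1" "p < q" "coprime p q" "k = real p / real q"
      using 3 by (auto simp: coprime_iff_gcd_eq_1)
    obtain m where m: "q = 2 * m" using assms(1) by blast
    have m2: "m \<ge> 2" using 3 m by simp
    have cop: "coprime (int p) (int m)"
      using p(3) m by simp
    \<comment> \<open>The average at the worst phase, which equals \<open>A q cos (\<pi>/q)\<close>.\<close>
    define \<delta> where "\<delta> = cot (pi / real q) / real m"
    have "pi / real q < pi"
      using 3 by (simp add: field_simps)
    then have s: "sin (pi / real q) > 0"
      using 3 by (intro sin_gt_zero) auto
    have "a > real m * sin (pi / real q)"
      using assms(2) 3 m by (simp add: A_def)
    moreover have "real m * sin (pi / real q) > 0" using s m2 by simp
    ultimately have a: "a > 0" "a / real m > sin (pi / real q)"
      using m2 by (auto simp: field_simps)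
    have "pi / real q < pi / 2"
      using 3 by (simp add: field_simps)
    then have "cos (pi / real q) > 0"
      using 3 by (intro cos_gt_zero) auto
    then have "sin (pi / real q) * cot (pi / real q) < a / real m * cot (pi / real q)"
      using a(2) s by (intro mult_strict_right_mono) (auto simp: cot_def)
    then have "cos (pi / real q) < a * \<delta>"
      using s by (simp add: \<delta>_def cot_def mult.commute)
    moreover have "sin (pi * k) \<le> cos (pi / real q)"
      unfolding p(4) by (rule sin_rational_le_cos[OF assms(1) 3 p(1-3)])
    ultimately have "sin (pi * k) < a * \<delta>" by linarith
    moreover have "real m * \<delta> \<le> (\<Sum>j<m. \<bar>sin (x + 2 * (pi * k) * real j)\<bar>)" for x
    proof -
      have "real m * \<delta> = cot (pi / (2 * real m))"
        using m2 by (simp add: \<delta>_def m)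
      also have "\<dots> \<le> (\<Sum>j<m. \<bar>sin (x + pi * of_int (int p) * real j / real m)\<bar>)"
        using m2 cop by (intro sum_abs_sin_equidistant_ge) auto
      finally show ?thesis
        by (simp add: p(4) m)
    qed
    ultimately show ?thesis
      unfolding k(3) using \<kappa> a(1) m2 by (intro feedback_eigenvalue[where N = m and \<delta> = \<delta>]) auto
  qed
qed

end
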